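(* Let $p\in\mathbb{R}$. The inequality $Z_p(a,b)<Y(a,b)$ holds for all $a,b>0$ with $a\neq b$ if and only if $p\le \frac23$.
   Context: For $a,b>0$ the power-exponential mean is $Z(a,b)=a^{\frac{a}{a+b}}b^{\frac{b}{a+b}}$; for $p\in\mathbb{R}$, $Z_p(a,b)=\left(Z(a^p,b^p)\right)^{1/p}$ if $p\neq0$ and $Z_0(a,b)=\sqrt{ab}$. The exponential-geometric mean is $Y(a,b)=I(a,b)\exp\left(1-\dfrac{G(a,b)^2}{L(a,b)^2}\right)$, where $G(a,b)=\sqrt{ab}$ is the geometric mean, $L(a,b)=\dfrac{a-b}{\ln a-\ln b}$ for $a\ne b$ (and $L(a,a)=a$) is the logarithmic mean, and $I(a,b)=e^{-1}\left(\dfrac{a^a}{b^b}\right)^{1/(a-b)}$ for $a\neq b$ (and $I(a,a)=a$) is the identric (exponential) mean. *)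

theory Defs
  imports Complex_Main
begin

text \<open>All means are meant for positive arguments; values elsewhere are irrelevant.\<close>

definition geometric_mean :: "real \<Rightarrow> real \<Rightarrow> real" where
  "geometric_mean a b = sqrt (a * b)"

definition logarithmic_mean :: "real \<Rightarrow> real \<Rightarrow> real" where
  "logarithmic_mean a b = (if a = b then a else (a - b) / (ln a - ln b))"

definition identric_mean :: "real \<Rightarrow> real \<Rightarrow> real" where
  "identric_mean a b =
     (if a = b then a else exp (-1) * ((a powr a) / (b powr b)) powr (1 / (a - b)))"

definition power_exponential_mean :: "real \<Rightarrow> real \<Rightarrow> real" where
  "power_exponential_mean a b = a powr (a / (a + b)) * b powr (b / (a + b))"

definition power_exponential_mean_order :: "real \<Rightarrow> real \<Rightarrow> real \<Rightarrow> real" where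
  "power_exponential_mean_order p a b =
     (if p = 0 then sqrt (a * b)
      else power_exponential_mean (a powr p) (b powr p) powr (1 / p))"

definition exponential_geometric_mean :: "real \<Rightarrow> real \<Rightarrow> real" where
  "exponential_geometric_mean a b =
     identric_mean a b * exp (1 - (geometric_mean a b)\<^sup>2 / (logarithmic_mean a b)\<^sup>2)"

end

theory Submission
  imports Defs "HOL-Real_Asymp.Real_Asymp"
begin

text \<open>
  Both means are homogeneous of degree one, so everything depends on half the logarithmic ratio of
  the arguments.  With \<open>a = exp (m + t)\<close> and \<open>b = exp (m - t)\<close> one finds
  \<open>ln (Z\<^sub>p a b) = m + t * tanh (p * t)\<close> and
  \<open>ln (Y a b) = m + t * cosh t / sinh t - (t / sinh t)\<^sup>2\<close>, and the inequality between the means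
  becomes \<open>tanh (p * t) < (sinh (2 * t) - 2 * t) / (cosh (2 * t) - 1)\<close> for \<open>t > 0\<close>
  (both exponents are even in \<open>t\<close>).

  As \<open>t\<close> tends to \<open>0\<close> from the right, the two sides divided by \<open>t\<close> tend to \<open>p\<close> and \<open>2 / 3\<close>, so
  \<open>p \<le> 2 / 3\<close> is necessary.

  Conversely, \<open>tanh\<close> is increasing, so it suffices to treat \<open>p = 2 / 3\<close>.  With \<open>s = 2 * t / 3\<close>
  one has \<open>2 * t = 3 * s\<close>; after clearing denominators the addition formula turns
  \<open>sinh (3 * s) * cosh s - cosh (3 * s) * sinh s\<close> into \<open>sinh (2 * s)\<close>, and what is left is exactly
  the hyperbolic Huygens inequality \<open>3 * s < 2 * sinh s + tanh s\<close>.
\<close>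

text \<open>
  The derivative of the difference is \<open>2 * c + 1 / c\<^sup>2 - 3\<close> with \<open>c = cosh x\<close>, which is positive
  for \<open>c > 1\<close> because it equals \<open>(c - 1)\<^sup>2 * (2 * c + 1) / c\<^sup>2\<close>.
\<close>

lemma huygens_hyperbolic:
  fixes s :: real
  assumes "s > 0"
  shows "3 * s < 2 * sinh s + tanh s"
proof -
  define g where "g = (\<lambda>x::real. 2 * sinh x + tanh x - 3 * x)"
  have "g 0 < g s"
  proof (rule DERIV_pos_imp_increasing_open[OF assms])
    fix x :: real
    assume x: "0 < x"
    have c: "cosh x > 1"
      using cosh_real_strict_mono[of 0 x] x by simp
    have "(g has_real_derivative 2 * cosh x + (1 - (tanh x)\<^sup>2) - 3) (at x)"
      unfolding g_def by (auto intro!: derivative_eq_intros)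
    moreover have "1 - (tanh x)\<^sup>2 = 1 / (cosh x)\<^sup>2"
      using c sinh_square_eq[of x] by (simp add: tanh_def power_divide diff_divide_distrib)
    moreover have "2 * cosh x + 1 / (cosh x)\<^sup>2 - 3 = (cosh x - 1)\<^sup>2 * (2 * cosh x + 1) / (cosh x)\<^sup>2"
      using c by (simp add: field_simps power2_eq_square)
    moreover have "(cosh x - 1)\<^sup>2 * (2 * cosh x + 1) / (cosh x)\<^sup>2 > 0"
      using c by (intro divide_pos_pos mult_pos_pos) auto
    ultimately show "\<exists>y. (g has_real_derivative y) (at x) \<and> y > 0"
      by (metis add_diff_eq)
  next
    show "continuous_on {0..s} g"
      unfolding g_def by (intro continuous_intros) auto
  qed
  thus ?thesis by (simp add: g_def)
qed

text \<open>
  This is the critical exponent in disguise: after multiplication by the positive denominators it is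
  the Huygens inequality at \<open>s = 2 * t / 3\<close>, multiplied by \<open>cosh s\<close>.
\<close>

lemma tanh_less_at_two_thirds:
  fixes t :: real
  assumes "t > 0"
  shows "tanh (2 / 3 * t) < (sinh (2 * t) - 2 * t) / (cosh (2 * t) - 1)"
proof -
  define s where "s = 2 / 3 * t"
  have s: "s > 0" and t: "2 * t = 3 * s"
    using assms by (auto simp: s_def)
  have cosh3: "cosh (3 * s) > 1"
    using cosh_real_strict_mono[of 0 "3 * s"] s by simp
  have "sinh (3 * s) * cosh s - cosh (3 * s) * sinh s = 2 * sinh s * cosh s"
    using sinh_diff[of "3 * s" s] sinh_double[of s] by simp
  moreover have "3 * s * cosh s < 2 * sinh s * cosh s + sinh s"
    using mult_strict_right_mono[OF huygens_hyperbolic[OF s], of "cosh s"]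
    by (simp add: tanh_def distrib_right)
  ultimately have "sinh s * (cosh (3 * s) - 1) < (sinh (3 * s) - 3 * s) * cosh s"
    by (simp add: algebra_simps)
  hence "tanh s < (sinh (3 * s) - 3 * s) / (cosh (3 * s) - 1)"
    using cosh3 by (simp add: tanh_def divide_simps)
  thus ?thesis
    unfolding t s_def[symmetric] .
qed

text \<open>
  Both sides vanish at \<open>0\<close>, so the bound is read off from their slopes there: \<open>p\<close> on the left and
  \<open>2 / 3\<close> on the right.
\<close>

lemma le_two_thirds_if_tanh_less:
  fixes p :: real
  assumes "\<And>t. t > 0 \<Longrightarrow> tanh (p * t) < (sinh (2 * t) - 2 * t) / (cosh (2 * t) - 1)"
  shows "p \<le> 2 / 3"
proof (rule tendsto_le)
  have "((\<lambda>t. tanh (p * t)) has_real_derivative p) (at 0)"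
    by (auto intro!: derivative_eq_intros)
  hence "((\<lambda>t. tanh (p * t) / t) \<longlongrightarrow> p) (at 0)"
    by (simp add: DERIV_def)
  thus "((\<lambda>t. tanh (p * t) / t) \<longlongrightarrow> p) (at_right 0)"
    by (rule filterlim_mono) (auto simp: at_le)
  show "((\<lambda>t. (sinh (2 * t) - 2 * t) / (cosh (2 * t) - 1) / t) \<longlongrightarrow> (2 / 3 :: real)) (at_right 0)"
    by real_asymp
  show "\<forall>\<^sub>F t in at_right 0. tanh (p * t) / t \<le> (sinh (2 * t) - 2 * t) / (cosh (2 * t) - 1) / t"
    using eventually_at_right_less[of "0::real"]
  proof eventually_elim
    case (elim t)
    thus ?case
      using assms[of t] by (intro divide_right_mono) auto
  qed
qed simp

text \<open>
  The weights \<open>a powr p\<close> and \<open>b powr p\<close> make \<open>ln Z\<^sub>p\<close> a weighted average of \<open>m + t\<close> and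
  \<open>m - t\<close>, which is \<open>m\<close> plus \<open>t\<close> times the relative difference of the weights.  The separate
  value at \<open>p = 0\<close> fits the same formula because \<open>tanh 0 = 0\<close>.
\<close>

lemma power_exponential_mean_order_exp:
  "power_exponential_mean_order p (exp (m + t)) (exp (m - t)) = exp (m + t * tanh (p * t))"
proof (cases "p = 0")
  case True
  have "exp (m + t) * exp (m - t) = (exp m)\<^sup>2"
    by (simp add: power2_eq_square flip: exp_add)
  thus ?thesis
    using True by (simp add: power_exponential_mean_order_def)
next
  case False
  define A B where "A = exp ((m + t) * p)" and "B = exp ((m - t) * p)"
  have pos: "A > 0" "B > 0" by (auto simp: A_def B_def)
  have "A = exp (m * p) * exp (p * t)" "B = exp (m * p) * exp (- (p * t))"
    by (simp_all add: A_def B_def algebra_simps flip: exp_add)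
  hence "(A - B) / (A + B) = (exp (m * p) * (exp (p * t) - exp (- (p * t)))) /
      (exp (m * p) * (exp (p * t) + exp (- (p * t))))"
    by (simp only: right_diff_distrib distrib_left)
  also have "\<dots> = tanh (p * t)"
    by (simp add: tanh_altdef)
  finally have tanh: "(A - B) / (A + B) = tanh (p * t)" .
  have "power_exponential_mean_order p (exp (m + t)) (exp (m - t)) =
      exp (((m + t) * p * (A / (A + B)) + (m - t) * p * (B / (A + B))) * (1 / p))"
    using False
    by (simp add: power_exponential_mean_order_def power_exponential_mean_def A_def B_def
        exp_powr_real flip: exp_add)
  also have "((m + t) * p * (A / (A + B)) + (m - t) * p * (B / (A + B))) * (1 / p) =
      m + t * ((A - B) / (A + B))"
    using False pos by (simp add: divide_simps) (simp add: algebra_simps)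
  finally show ?thesis
    by (simp only: tanh)
qed

text \<open>
  Here \<open>G\<close> is \<open>exp m\<close>, \<open>L\<close> is \<open>exp m * sinh t / t\<close> and \<open>ln I\<close> is \<open>m + t * cosh t / sinh t - 1\<close>;
  the constant \<open>1\<close> in the definition of \<open>Y\<close> cancels the \<open>- 1\<close> of \<open>ln I\<close>.
\<close>

lemma exponential_geometric_mean_exp:
  assumes "t \<noteq> 0"
  shows "exponential_geometric_mean (exp (m + t)) (exp (m - t)) =
    exp (m + t * cosh t / sinh t - (t / sinh t)\<^sup>2)"
proof -
  define A B where "A = exp (m + t)" and "B = exp (m - t)"
  have pos: "A > 0" "B > 0" and ne: "A \<noteq> B"
    using assms by (auto simp: A_def B_def)
  have AB: "A = exp m * exp t" "B = exp m * exp (- t)"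
    by (simp_all add: A_def B_def flip: exp_add)
  have diff: "A - B = 2 * exp m * sinh t" and sum: "A + B = 2 * exp m * cosh t"
    by (simp_all add: AB sinh_field_def cosh_field_def algebra_simps)
  have sinh: "sinh t \<noteq> 0" using assms by simp
  have "(A powr A) / (B powr B) = exp ((m + t) * A - (m - t) * B)"
    using pos by (simp add: powr_def exp_diff mult.commute) (simp add: A_def B_def)
  hence "identric_mean A B = exp (- 1 + ((m + t) * A - (m - t) * B) * (1 / (A - B)))"
    using ne by (simp add: identric_mean_def exp_powr_real flip: exp_add)
  also have "((m + t) * A - (m - t) * B) * (1 / (A - B)) = m + t * (A + B) / (A - B)"
    using ne by (simp add: field_simps)
  also have "t * (A + B) / (A - B) = t * cosh t / sinh t"
    by (simp add: sum diff)
  finally have I: "identric_mean A B = exp (- 1 + (m + t * cosh t / sinh t))" .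
  have L: "logarithmic_mean A B = exp m * sinh t / t"
  proof -
    have "ln A - ln B = 2 * t" by (simp add: A_def B_def)
    thus ?thesis using ne by (simp add: logarithmic_mean_def diff)
  qed
  have G: "(geometric_mean A B)\<^sup>2 = (exp m)\<^sup>2"
    using pos by (simp add: geometric_mean_def)
      (simp add: A_def B_def power2_eq_square flip: exp_add)
  have "(geometric_mean A B)\<^sup>2 / (logarithmic_mean A B)\<^sup>2 = (t / sinh t)\<^sup>2"
    unfolding G L using assms sinh by (simp add: power_divide power_mult_distrib)
  hence "exponential_geometric_mean A B =
      exp (- 1 + (m + t * cosh t / sinh t)) * exp (1 - (t / sinh t)\<^sup>2)"
    by (simp add: exponential_geometric_mean_def I)
  also have "\<dots> = exp (m + t * cosh t / sinh t - (t / sinh t)\<^sup>2)"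
    by (simp flip: exp_add)
  finally show ?thesis by (simp only: A_def B_def)
qed

text \<open>
  Passing to the doubled angle leaves a single quotient, so that both exponents have the form
  \<open>m + t * _\<close> and the factor \<open>t\<close> can be cancelled.
\<close>

lemma coth_minus_square_eq:
  fixes t :: real
  assumes "t \<noteq> 0"
  shows "t * cosh t / sinh t - (t / sinh t)\<^sup>2 = t * ((sinh (2 * t) - 2 * t) / (cosh (2 * t) - 1))"
proof -
  have "cosh (2 * t) - 1 = 2 * (sinh t)\<^sup>2"
    using cosh_square_eq[of t] by (simp add: cosh_double)
  moreover have "sinh (2 * t) = 2 * sinh t * cosh t"
    by (rule sinh_double)
  ultimately show ?thesis
    using assms by (simp only:) (simp add: field_simps power2_eq_square)
qed

lemma mean_less_exp_iff:
  assumes "t > 0"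
  shows "power_exponential_mean_order p (exp (m + t)) (exp (m - t)) <
      exponential_geometric_mean (exp (m + t)) (exp (m - t)) \<longleftrightarrow>
    tanh (p * t) < (sinh (2 * t) - 2 * t) / (cosh (2 * t) - 1)"
proof -
  have "power_exponential_mean_order p (exp (m + t)) (exp (m - t)) <
      exponential_geometric_mean (exp (m + t)) (exp (m - t)) \<longleftrightarrow>
    t * tanh (p * t) < t * cosh t / sinh t - (t / sinh t)\<^sup>2"
    using assms by (simp add: power_exponential_mean_order_exp exponential_geometric_mean_exp
        flip: add_diff_eq)
  also have "t * cosh t / sinh t - (t / sinh t)\<^sup>2 =
      t * ((sinh (2 * t) - 2 * t) / (cosh (2 * t) - 1))"
    using assms by (intro coth_minus_square_eq) simp
  finally show ?thesis
    using mult_less_cancel_left_pos[OF assms] by blast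
qed

text \<open>
  Swapping the two arguments replaces \<open>t\<close> by \<open>- t\<close>, and both exponents are even in \<open>t\<close>.
\<close>

lemma mean_less_swap_iff:
  assumes "t \<noteq> 0"
  shows "power_exponential_mean_order p (exp (m - t)) (exp (m + t)) <
      exponential_geometric_mean (exp (m - t)) (exp (m + t)) \<longleftrightarrow>
    power_exponential_mean_order p (exp (m + t)) (exp (m - t)) <
      exponential_geometric_mean (exp (m + t)) (exp (m - t))"
  using assms power_exponential_mean_order_exp[of p m "- t"] exponential_geometric_mean_exp[of "- t" m]
  by (simp add: power_exponential_mean_order_exp exponential_geometric_mean_exp)

theorem theorem7:
  fixes p :: real
  shows "(\<forall>a b :: real. a > 0 \<and> b > 0 \<and> a \<noteq> b \<longrightarrow>
            power_exponential_mean_order p a b < exponential_geometric_mean a b)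
         \<longleftrightarrow> p \<le> 2 / 3"
proof
  assume means: "\<forall>a b :: real. a > 0 \<and> b > 0 \<and> a \<noteq> b \<longrightarrow>
    power_exponential_mean_order p a b < exponential_geometric_mean a b"
  show "p \<le> 2 / 3"
  proof (rule le_two_thirds_if_tanh_less)
    fix t :: real
    assume t: "t > 0"
    hence "power_exponential_mean_order p (exp (0 + t)) (exp (0 - t)) <
        exponential_geometric_mean (exp (0 + t)) (exp (0 - t))"
      using means by simp
    thus "tanh (p * t) < (sinh (2 * t) - 2 * t) / (cosh (2 * t) - 1)"
      using mean_less_exp_iff[OF t] by blast
  qed
next
  assume p: "p \<le> 2 / 3"
  have less: "power_exponential_mean_order p (exp (m + t)) (exp (m - t)) <
      exponential_geometric_mean (exp (m + t)) (exp (m - t))" if t: "t > 0" for m t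
  proof -
    have "tanh (p * t) \<le> tanh (2 / 3 * t)"
      using mult_right_mono[OF p, of t] t by simp
    also note tanh_less_at_two_thirds[OF t]
    finally show ?thesis using mean_less_exp_iff[OF t] by blast
  qed
  show "\<forall>a b :: real. a > 0 \<and> b > 0 \<and> a \<noteq> b \<longrightarrow>
    power_exponential_mean_order p a b < exponential_geometric_mean a b"
  proof (intro allI impI)
    fix a b :: real
    assume ab: "a > 0 \<and> b > 0 \<and> a \<noteq> b"
    define m t where "m = (ln a + ln b) / 2" and "t = (ln a - ln b) / 2"
    have "ln a = m + t" "ln b = m - t"
      by (simp_all add: m_def t_def field_simps)
    hence eq: "a = exp (m + t)" "b = exp (m - t)"
      using ab by (metis exp_ln)+
    with ab consider "t > 0" | "t < 0"
      by fastforce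
    thus "power_exponential_mean_order p a b < exponential_geometric_mean a b"
    proof cases
      case 1
      thus ?thesis using less eq by simp
    next
      case 2
      thus ?thesis
        using less[of "- t" m] mean_less_swap_iff[of t p m] eq by simp
    qed
  qed
qed

end
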